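(* Let $G_1$ and $G_2$ be finite groups whose power graphs $\mathcal{P}(G_1)$ and $\mathcal{P}(G_2)$ are isomorphic as graphs. Then their directed power graphs $\vec{\mathcal{P}}(G_1)$ and $\vec{\mathcal{P}}(G_2)$ are isomorphic as digraphs.
   Context: For a group $G$, the power graph $\mathcal{P}(G)$ is the simple undirected graph with vertex set $G$ in which distinct $x,y$ are adjacent iff there is a positive integer $m$ with $x=y^m$ or $y=x^m$. The directed power graph $\vec{\mathcal{P}}(G)$ is the digraph with vertex set $G$ and arc set $\{(x,y)\in G^2: x\neq y,\ y=x^m \text{ for some positive integer } m\}$. *)

theory Defs
  imports "HOL-Algebra.Group" "Graph_Theory.Pair_Digraph" "Graph_Theory.Digraph_Isomorphism"
begin

text \<open>
  A simple undirected graph is modelled as a symmetric loop-free digraph without parallel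
  arcs (the locale \<open>graph\<close> of \<open>Graph_Theory\<close>): an edge between \<open>x\<close> and \<open>y\<close> is the pair of
  arcs \<open>(x, y)\<close> and \<open>(y, x)\<close>. On such graphs \<open>digraph_iso\<close> is the usual isomorphism of
  simple graphs, see \<open>digraph_iso_pair_iff\<close> below.
\<close>

definition power_graph :: "('a, 'm) monoid_scheme \<Rightarrow> 'a pair_pre_digraph" where
  "power_graph G =
     \<lparr> pverts = carrier G,
       parcs = {(x, y). x \<in> carrier G \<and> y \<in> carrier G \<and> x \<noteq> y \<and>
         (\<exists>m::nat. m > 0 \<and> (x = y [^]\<^bsub>G\<^esub> m \<or> y = x [^]\<^bsub>G\<^esub> m))} \<rparr>"

definition directed_power_graph :: "('a, 'm) monoid_scheme \<Rightarrow> 'a pair_pre_digraph" where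
  "directed_power_graph G =
     \<lparr> pverts = carrier G,
       parcs = {(x, y). x \<in> carrier G \<and> y \<in> carrier G \<and> x \<noteq> y \<and>
         (\<exists>m::nat. m > 0 \<and> y = x [^]\<^bsub>G\<^esub> m)} \<rparr>"

lemma pair_graph_power_graph:
  assumes "finite (carrier G)"
  shows "pair_graph (power_graph G)"
proof -
  have "parcs (power_graph G) \<subseteq> carrier G \<times> carrier G"
    by (auto simp: power_graph_def)
  then have "finite (parcs (power_graph G))"
    using assms by (meson finite_SigmaI finite_subset)
  then show ?thesis
    using assms
    by unfold_locales (auto simp: power_graph_def symmetric_def sym_def)
qed

lemma pair_digraph_directed_power_graph:
  assumes "finite (carrier G)"
  shows "pair_digraph (directed_power_graph G)"
proof -
  have "parcs (directed_power_graph G) \<subseteq> carrier G \<times> carrier G"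
    by (auto simp: directed_power_graph_def)
  then have "finite (parcs (directed_power_graph G))"
    using assms by (meson finite_SigmaI finite_subset)
  then show ?thesis
    using assms by unfold_locales (auto simp: directed_power_graph_def)
qed

lemma digraph_iso_pair_iff:
  assumes "pair_wf_digraph G" "pair_wf_digraph H"
  shows "digraph_iso (with_proj G) (with_proj H) \<longleftrightarrow>
    (\<exists>f. bij_betw f (pverts G) (pverts H) \<and>
      (\<forall>x\<in>pverts G. \<forall>y\<in>pverts G. (x, y) \<in> parcs G \<longleftrightarrow> (f x, f y) \<in> parcs H))"
    (is "?L \<longleftrightarrow> ?R")
proof
  interpret G: pair_wf_digraph G by fact
  assume ?L
  then obtain h where h: "pre_digraph.digraph_isomorphism (with_proj G) h"
    and H: "with_proj H = app_iso h (with_proj G)"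
    unfolding digraph_iso_def by blast
  have v: "pverts H = iso_verts h ` pverts G" and a: "parcs H = iso_arcs h ` parcs G"
    and t: "iso_tail h = fst" "iso_head h = snd"
    using arg_cong[OF H, of verts] arg_cong[OF H, of arcs]
      arg_cong[OF H, of tail] arg_cong[OF H, of head] by simp_all
  have inj: "inj_on (iso_verts h) (pverts G)"
    using h by (simp add: pre_digraph.digraph_isomorphism_def)
  have e: "iso_arcs h (x, y) = (iso_verts h x, iso_verts h y)" if "(x, y) \<in> parcs G" for x y
    using h that by (auto simp: pre_digraph.digraph_isomorphism_def t prod_eq_iff)
  have "(x, y) \<in> parcs G \<longleftrightarrow> (iso_verts h x, iso_verts h y) \<in> parcs H"
    if "x \<in> pverts G" "y \<in> pverts G" for x y
  proof
    assume "(x, y) \<in> parcs G"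
    then show "(iso_verts h x, iso_verts h y) \<in> parcs H"
      unfolding a using e by (metis image_eqI)
  next
    assume "(iso_verts h x, iso_verts h y) \<in> parcs H"
    then obtain u w where "(u, w) \<in> parcs G" "iso_verts h u = iso_verts h x"
      "iso_verts h w = iso_verts h y"
      unfolding a using e by auto
    then show "(x, y) \<in> parcs G"
      using inj that by (metis G.in_arcsD1 G.in_arcsD2 inj_onD)
  qed
  then show ?R using inj v by (auto simp: bij_betw_def)
next
  interpret G: pair_wf_digraph G by fact
  interpret H: pair_wf_digraph H by fact
  assume ?R
  then obtain f where f: "bij_betw f (pverts G) (pverts H)"
    and e: "\<And>x y. x \<in> pverts G \<Longrightarrow> y \<in> pverts G \<Longrightarrow> (x, y) \<in> parcs G \<longleftrightarrow> (f x, f y) \<in> parcs H"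
    by blast
  let ?h = "\<lparr> iso_verts = f, iso_arcs = map_prod f f, iso_head = snd, iso_tail = fst \<rparr>"
  have inj: "inj_on f (pverts G)" and im: "f ` pverts G = pverts H"
    using f by (auto simp: bij_betw_def)
  have "inj_on (map_prod f f) (parcs G)"
    by (rule inj_on_subset[OF map_prod_inj_on[OF inj inj]]) (auto dest: G.wellformed')
  then have "pre_digraph.digraph_isomorphism (with_proj G) ?h"
    unfolding pre_digraph.digraph_isomorphism_def
    using inj G.wf_digraph_axioms by (auto simp: map_prod_def split_beta)
  moreover have "map_prod f f ` parcs G = parcs H"
  proof (intro equalityI subrelI)
    fix u w assume "(u, w) \<in> map_prod f f ` parcs G"
    then show "(u, w) \<in> parcs H" using e by (auto dest: G.wellformed')
  next
    fix u w assume uw: "(u, w) \<in> parcs H"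
    then obtain x y where "x \<in> pverts G" "y \<in> pverts G" "u = f x" "w = f y"
      using im by (metis H.in_arcsD1 H.in_arcsD2 imageE)
    then show "(u, w) \<in> map_prod f f ` parcs G"
      using e uw by (auto intro!: image_eqI[where x = "(x, y)"])
  qed
  then have "with_proj H = app_iso ?h (with_proj G)"
    using im by (simp add: with_proj_def app_iso_def)
  ultimately show ?L unfolding digraph_iso_def by blast
qed

end

theory Submission
  imports Defs "HOL-Algebra.Multiplicative_Group" "HOL-Number_Theory.Totient"
    "HOL-Combinatorics.Transposition"
begin

text \<open>
  Write \<open>\<langle>x\<rangle>\<close> for the cyclic subgroup generated by \<open>x\<close>. In a finite group the directed power
  graph has an arc from \<open>x\<close> to \<open>y \<noteq> x\<close> iff \<open>y \<in> \<langle>x\<rangle>\<close>, and the power graph forgets the direction.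
  If \<open>x\<close> and \<open>y\<close> are adjacent, then both lie in one cyclic group, where subgroups are
  determined by their orders, so \<open>y \<in> \<langle>x\<rangle>\<close> iff \<open>ord y dvd ord x\<close>. Hence a bijection that
  preserves adjacency \<^emph>\<open>and\<close> element orders is an isomorphism of directed power graphs, and it
  suffices to turn the given isomorphism \<open>f\<close> into such a bijection.

  This is possible because \<open>f\<close> may be composed with any permutation that moves elements only
  within classes of closed twins, i.e. of elements with the same closed neighbourhood. Since
  the identity is adjacent to everything, this freedom allows one to assume \<open>f \<one> = \<one>\<close>. Then \<open>f\<close>
  maps each twin class \<open>C\<close> of non-identity elements onto such a class, and all that has to be
  shown is that the number of elements of each order in \<open>C\<close> can be read off from the graph.

  Any two members of a class \<open>C\<close> are adjacent, so \<open>C\<close> lies in \<open>\<langle>t\<rangle>\<close> for one of its members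
  \<open>t\<close>, and it is convex (\<open>nbhd_convex\<close>): the elements of \<open>\<langle>t\<rangle>\<close> outside \<open>C\<close> are exactly the
  elements strictly below every member of \<open>C\<close>. If there are \<open>b\<close> of them, then
  \<open>ord t = b + card C\<close> and \<open>C = {z \<in> \<langle>t\<rangle>. b < ord z}\<close>, so that \<open>C\<close> contains
  \<open>totient d\<close> elements of order \<open>d\<close> if \<open>d > b\<close> divides \<open>b + card C\<close>, and none otherwise
  (\<open>card_twins_of_ord\<close>). As \<open>f\<close> preserves \<open>card C\<close>, it remains to see that it preserves \<open>b\<close>, for
  which it is enough that \<open>f\<close> preserves the direction of arcs between different twin classes.

  For this, let the class \<open>C\<close> lie above the class \<open>D\<close>. If \<open>D\<close> contains elements of different
  orders, then all elements above \<open>D\<close> have prime power order (\<open>prime_power_above_twin\<close>) and a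
  count gives \<open>card D < card C\<close>. Otherwise \<open>card D = totient m\<close> where \<open>m\<close> properly divides the order \<open>n\<close>
  of a member of \<open>C\<close>, and again \<open>card D \<le> card C\<close>. Equality forces \<open>m\<close> to be odd and \<open>n\<close> to be even, and then
  some involution is adjacent to a member of \<open>C\<close> and is its own twin class, whereas no
  involution is adjacent to an element of odd order \<open>m > 1\<close>. Thus class sizes, together with
  adjacency to classes of size one in case of a tie, reveal the direction
  (\<open>card_twins_cases\<close>, \<open>mem_cyc_image\<close>).
\<close>


section \<open>Two facts about natural numbers\<close>

lemma prime_power_of_unique_prime_divisor:
  fixes n p :: nat
  assumes "n > 0" and "prime p" and uniq: "\<And>q. prime q \<Longrightarrow> q dvd n \<Longrightarrow> q = p"
  obtains k where "n = p ^ k"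
proof -
  obtain l where l: "n = p ^ multiplicity p n * l" "\<not> p dvd l"
    using multiplicity_decompose'[of n p] assms
    by (metis not_gr_zero not_prime_unit)
  have "l = 1"
  proof (rule ccontr)
    assume "l \<noteq> 1"
    then obtain q where q: "prime q" "q dvd l" using prime_factor_nat by blast
    then have "q dvd n" using l(1) by (metis dvd_mult)
    with uniq q l(2) show False by blast
  qed
  with l(1) that show thesis by simp
qed

text \<open>If a prime \<open>q\<close> divides \<open>n div m\<close>, then \<open>totient (m * q)\<close> lies between two equal numbers;
  but the step from \<open>m\<close> to \<open>m * q\<close> multiplies the totient by \<open>q\<close> or by \<open>q - 1\<close>, which is \<open>1\<close>
  only for \<open>q = 2\<close> and odd \<open>m\<close>.\<close>

lemma totient_eq_imp_odd:
  fixes m n :: nat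
  assumes "m dvd n" "m \<noteq> n" "n > 0" and eq: "totient m = totient n"
  shows "odd m \<and> even n"
proof -
  obtain c where c: "n = m * c" using assms(1) ..
  have "c \<noteq> 1" using c assms(2) by auto
  then obtain q where q: "prime q" "q dvd c" using prime_factor_nat by blast
  have mq: "m * q dvd n" using c q by simp
  have m0: "m > 0" using c assms(3) by simp
  have "totient m \<le> totient (m * q)" "totient (m * q) \<le> totient n"
    using totient_dvd_mono[of m "m * q"] totient_dvd_mono[OF mq] assms(3) m0 q(1)
    by (auto simp: prime_gt_0_nat)
  then have teq: "totient (m * q) = totient m" using eq by simp
  have "\<not> q dvd m"
  proof
    assume "q dvd m"
    then have "gcd m q = q" by (simp add: gcd_nat.absorb2)
    then have "totient m * totient q = totient m * totient q * q"
      using totient_gcd[of m q] teq by simp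
    moreover have "totient m * totient q > 0" using m0 q(1) by (simp add: prime_gt_0_nat)
    ultimately have "q = 1" by simp
    then show False using q(1) by simp
  qed
  then have cop: "coprime m q"
    using q(1) prime_imp_coprime coprime_commute by blast
  then have "totient m * (q - 1) = totient m"
    using teq q(1) by (simp add: totient_mult_coprime totient_prime)
  then have "q = 2" using m0 by simp
  then show ?thesis using cop mq by auto
qed


section \<open>Cyclic subgroups of a finite group\<close>

locale finite_group = group +
  assumes finite_carrier: "finite (carrier G)"
begin

abbreviation cyc :: "'a \<Rightarrow> 'a set" where "cyc x \<equiv> generate G {x}"

lemma cyc_pow: "x \<in> carrier G \<Longrightarrow> cyc x = range (\<lambda>k::nat. x [^] k)"
  using generate_pow_on_finite_carrier[OF finite_carrier, of x] by auto

lemma cyc_carrier: "x \<in> carrier G \<Longrightarrow> y \<in> cyc x \<Longrightarrow> y \<in> carrier G"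
  using generate_in_carrier[of "{x}" y] by simp

lemma finite_cyc: "x \<in> carrier G \<Longrightarrow> finite (cyc x)"
  using finite_carrier cyc_carrier by (meson finite_subset subsetI)

lemma self_in_cyc: "x \<in> cyc x"
  by (simp add: generate.incl)

lemma one_in_cyc: "\<one> \<in> cyc x"
  by (rule generate.one)

lemma cyc_mono: "x \<in> carrier G \<Longrightarrow> y \<in> cyc x \<Longrightarrow> cyc y \<subseteq> cyc x"
  by (rule generate_subgroup_incl) (auto intro: generate_is_subgroup)

lemma cyc_trans: "x \<in> carrier G \<Longrightarrow> y \<in> cyc x \<Longrightarrow> z \<in> cyc y \<Longrightarrow> z \<in> cyc x"
  using cyc_mono by blast

lemma card_cyc: "x \<in> carrier G \<Longrightarrow> card (cyc x) = ord x"
  by (simp add: generate_pow_card)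

lemma ord_pos: "x \<in> carrier G \<Longrightarrow> ord x > 0"
  using ord_ge_1[OF finite_carrier, of x] by simp

lemma ord_gt_1: "x \<in> carrier G \<Longrightarrow> x \<noteq> \<one> \<Longrightarrow> ord x > 1"
  using ord_pos[of x] ord_eq_1[of x] by linarith

lemma cyc_one: "cyc \<one> = {\<one>}"
  by (auto simp: cyc_pow)

lemma ord_dvd_of_mem_cyc:
  assumes "x \<in> carrier G" "y \<in> cyc x"
  shows "ord y dvd ord x"
proof -
  obtain k :: nat where "y = x [^] k" using assms cyc_pow by auto
  then have "y [^] ord x = \<one>"
    using assms(1) by (metis mult.commute nat_pow_pow nat_pow_one pow_ord_eq_1)
  then show ?thesis using assms cyc_carrier pow_eq_id by blast
qed

text \<open>A finite cyclic group has at most \<open>d\<close> elements whose \<open>d\<close>-th power is trivial, so the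
  subgroup of order \<open>d\<close> already consists of all of them.\<close>

lemma mem_cyc_iff_ord_dvd:
  assumes x: "x \<in> carrier G" and u: "u \<in> cyc x" and v: "v \<in> cyc x"
  shows "u \<in> cyc v \<longleftrightarrow> ord u dvd ord v"
proof
  have vG: "v \<in> carrier G" and uG: "u \<in> carrier G" using cyc_carrier x u v by auto
  show "u \<in> cyc v \<Longrightarrow> ord u dvd ord v" using ord_dvd_of_mem_cyc vG by blast
  assume dvd: "ord u dvd ord v"
  define d e where "d = ord v" and "e = ord x div ord v"
  have d: "d > 0" using ord_pos vG d_def by simp
  have n: "ord x = e * d" using ord_dvd_of_mem_cyc[OF x v] by (simp add: d_def e_def)
  \<comment> \<open>The elements of \<open>S\<close> are the powers of \<open>x [^] e\<close>, so there are at most \<open>d\<close> of them, which is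
    the size of the subgroup \<open>cyc v\<close> of \<open>S\<close>.\<close>
  define S where "S = {w \<in> cyc x. w [^] d = \<one>}"
  have "S \<subseteq> (\<lambda>j. x [^] (e * j)) ` {..<d}"
  proof
    fix w assume "w \<in> S"
    then obtain k :: nat where k: "w = x [^] k" and "w [^] d = \<one>"
      using cyc_pow x by (auto simp: S_def)
    then have "ord x dvd k * d" using x by (simp add: nat_pow_pow pow_eq_id)
    then have "e dvd k" using n d by simp
    then obtain j where j: "k = e * j" ..
    have "e * j = e * (d * (j div d) + j mod d)" by simp
    also have "\<dots> = (e * d) * (j div d) + e * (j mod d)"
      by (simp only: distrib_left mult.assoc)
    finally have "e * j = (e * d) * (j div d) + e * (j mod d)" .
    then have "x [^] (e * j) = x [^] (ord x * (j div d)) \<otimes> x [^] (e * (j mod d))"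
      using x n by (simp add: nat_pow_mult)
    also have "x [^] (ord x * (j div d)) = \<one>" using x by (simp add: pow_eq_id)
    finally have "w = x [^] (e * (j mod d))" using x k j by simp
    then show "w \<in> (\<lambda>j. x [^] (e * j)) ` {..<d}" using d by simp
  qed
  then have "card S \<le> d" using surj_card_le[of "{..<d}" S] by simp
  moreover have "cyc v \<subseteq> S"
  proof
    fix w assume w: "w \<in> cyc v"
    then have "w [^] d = \<one>"
      using ord_dvd_of_mem_cyc[OF vG w] cyc_carrier[OF vG w] by (simp add: d_def pow_eq_id)
    then show "w \<in> S" using cyc_trans[OF x v w] by (simp add: S_def)
  qed
  moreover have "finite S" using finite_cyc x by (simp add: S_def)
  ultimately have "cyc v = S"
    using card_cyc[OF vG] d_def by (simp add: card_seteq)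
  moreover have "u \<in> S" using u uG dvd by (simp add: S_def d_def pow_eq_id)
  ultimately show "u \<in> cyc v" by simp
qed

lemma card_ord_in_cyc:
  assumes x: "x \<in> carrier G" and d: "d dvd ord x"
  shows "card {z \<in> cyc x. ord z = d} = totient d"
proof -
  let ?n = "ord x"
  have n: "?n > 0" using ord_pos x .
  have d0: "d > 0" using d n by (auto intro: Nat.gr0I)
  have img: "{z \<in> cyc x. ord z = d} = (\<lambda>k. x [^] k) ` {k \<in> {0<..?n}. gcd k ?n = ?n div d}"
    (is "?L = ?R")
  proof
    show "?R \<subseteq> ?L" using x n d d0
      by (auto simp: cyc_pow ord_pow_gen gcd.commute)
    show "?L \<subseteq> ?R"
    proof
      fix z assume z: "z \<in> ?L"
      then obtain k :: nat where k: "z = x [^] k" using cyc_pow x by auto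
      \<comment> \<open>Exponents are normalised to \<open>1, \<dots>, ord x\<close>, the range in which totients count.\<close>
      define j where "j = (if k mod ?n = 0 then ?n else k mod ?n)"
      have j: "j \<in> {0<..?n}" using n by (auto simp: j_def intro: less_imp_le)
      have "x [^] k = x [^] (?n * (k div ?n)) \<otimes> x [^] (k mod ?n)"
        using x by (simp add: nat_pow_mult)
      also have "x [^] (?n * (k div ?n)) = \<one>" using x by (simp add: pow_eq_id)
      finally have zj: "z = x [^] j" using x k by (simp add: j_def)
      then have "?n div gcd ?n j = d" using z j x by (simp add: ord_pow_gen)
      then have "gcd j ?n = ?n div d"
        using d0 dvd_div_mult_self[OF gcd_dvd1, of ?n j] by (metis gcd.commute less_irrefl nonzero_mult_div_cancel_left)
      then show "z \<in> ?R" using zj j by blast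
    qed
  qed
  have "inj_on (\<lambda>k. x [^] k) {k \<in> {0<..?n}. gcd k ?n = ?n div d}"
    by (rule inj_on_subset[OF ord_inj'[OF x]]) auto
  then have "card {z \<in> cyc x. ord z = d} = card {k \<in> {0<..?n}. gcd k ?n = ?n div d}"
    unfolding img by (rule card_image)
  also have "\<dots> = totient (?n div (?n div d))"
    by (rule card_gcd_eq_totient[OF n]) (metis d dvd_mult_div_cancel dvd_triv_right)
  also have "?n div (?n div d) = d" using n d by (simp add: div_div_eq_right)
  finally show ?thesis .
qed

lemma ex_ord_in_cyc:
  assumes "x \<in> carrier G" and "d dvd ord x"
  obtains z where "z \<in> cyc x" "ord z = d"
proof -
  have "totient d > 0" using assms ord_pos by (metis dvd_pos_nat totient_gt_0_iff)
  then have "card {z \<in> cyc x. ord z = d} > 0" using card_ord_in_cyc assms by simp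
  then have "{z \<in> cyc x. ord z = d} \<noteq> {}" by (metis card.empty less_irrefl)
  then show thesis using that by blast
qed


section \<open>Adjacency and twin classes\<close>

text \<open>Adjacency is taken to be reflexive, so that neighbourhoods are closed. The identity is left
  out of the twin classes because it would destroy their convexity: in a cyclic group of order
  \<open>6\<close> it has the same neighbours as the generators, unlike the elements of order \<open>2\<close> and \<open>3\<close>
  in between.\<close>

definition adj :: "'a \<Rightarrow> 'a \<Rightarrow> bool" where
  "adj x y \<longleftrightarrow> x \<in> cyc y \<or> y \<in> cyc x"

definition nbhd :: "'a \<Rightarrow> 'a set" where
  "nbhd x = {y \<in> carrier G. adj x y}"

definition twins :: "'a \<Rightarrow> 'a set" where
  "twins x = {y \<in> carrier G. y \<noteq> \<one> \<and> nbhd y = nbhd x}"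

lemma adj_commute: "adj x y \<longleftrightarrow> adj y x"
  by (auto simp: adj_def)

lemma adj_refl: "adj x x"
  by (simp add: adj_def self_in_cyc)

text \<open>Adjacent elements lie in a common cyclic subgroup. Hence the element orders determine the
  directions of all edges.\<close>

lemma mem_cyc_iff_of_adj:
  assumes x: "x \<in> carrier G" and y: "y \<in> carrier G" and "adj x y"
  shows "y \<in> cyc x \<longleftrightarrow> ord y dvd ord x"
  using assms mem_cyc_iff_ord_dvd[OF x _ self_in_cyc, of y]
    mem_cyc_iff_ord_dvd[OF y self_in_cyc, of x] ord_dvd_of_mem_cyc[OF x]
  unfolding adj_def by blast

lemma adj_ord_dvd:
  assumes "x \<in> carrier G" "y \<in> carrier G" "adj x y"
  shows "ord x dvd ord y \<or> ord y dvd ord x"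
  using assms ord_dvd_of_mem_cyc by (auto simp: adj_def)

lemma nbhd_eq_of_mutual:
  assumes "x \<in> carrier G" "y \<in> cyc x" "x \<in> cyc y"
  shows "nbhd x = nbhd y"
proof -
  have "y \<in> carrier G" using assms cyc_carrier by blast
  then show ?thesis unfolding nbhd_def adj_def using assms cyc_trans by blast
qed

lemma adj_of_nbhd_eq:
  assumes "x \<in> carrier G" "nbhd x = nbhd y"
  shows "adj x y"
proof -
  have "x \<in> nbhd y" using assms adj_refl by (auto simp: nbhd_def)
  then show ?thesis using adj_commute by (simp add: nbhd_def)
qed

lemma adj_cong_nbhd:
  assumes "nbhd x = nbhd y" "z \<in> carrier G"
  shows "adj x z \<longleftrightarrow> adj y z"
  using assms by (auto simp: nbhd_def)

lemma finite_twins: "finite (twins x)"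
  using finite_carrier by (simp add: twins_def)

lemma twins_cong: "nbhd x = nbhd y \<Longrightarrow> twins x = twins y"
  by (simp add: twins_def)

lemma self_in_twins: "x \<in> carrier G \<Longrightarrow> x \<noteq> \<one> \<Longrightarrow> x \<in> twins x"
  by (simp add: twins_def)

text \<open>
  Let \<open>m = ord y\<close> be a proper divisor of \<open>n = ord x\<close>. As \<open>\<langle>x\<rangle>\<close> contains elements of every order
  \<open>d dvd n\<close> and \<open>y\<close> is adjacent to all of them, \<open>m\<close> is comparable to every divisor of \<open>n\<close>.
  Applied to the full \<open>p\<close>-part of \<open>n\<close>, where \<open>p\<close> divides \<open>n div m\<close>, this makes \<open>m\<close> a power
  of \<open>p\<close>; applied to the primes dividing \<open>n\<close>, it makes \<open>n\<close> a power of \<open>p\<close>. If some \<open>w\<close> above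
  \<open>y\<close> had order divisible by another prime \<open>q\<close>, then \<open>\<langle>w\<rangle>\<close> would contain an element of order
  \<open>m * q\<close> above \<open>y\<close>, which is not adjacent to the twin \<open>x\<close> of \<open>y\<close>.
\<close>

lemma prime_power_above_twin:
  assumes x: "x \<in> carrier G" and yx: "y \<in> cyc x" and y1: "y \<noteq> \<one>"
    and nb: "nbhd y = nbhd x" and ne: "ord y \<noteq> ord x"
  obtains p where "prime p"
    and "\<And>w. w \<in> carrier G \<Longrightarrow> y \<in> cyc w \<Longrightarrow> \<exists>k. ord w = p ^ k"
proof -
  have y: "y \<in> carrier G" using x yx cyc_carrier by blast
  let ?m = "ord y" and ?n = "ord x"
  have m1: "?m > 1" using y y1 ord_gt_1 by simp
  have mn: "?m dvd ?n" using ord_dvd_of_mem_cyc x yx by blast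
  have n0: "?n > 0" using ord_pos x .
  have comparable: "d dvd ?m \<or> ?m dvd d" if "d dvd ?n" for d
  proof -
    obtain z where z: "z \<in> cyc x" "ord z = d" using ex_ord_in_cyc[OF x \<open>d dvd ?n\<close>] .
    then have zG: "z \<in> carrier G" using x cyc_carrier by blast
    have "adj y z" using adj_cong_nbhd[OF nb zG] z by (simp add: adj_def)
    then show ?thesis using adj_ord_dvd[OF y zG] z by auto
  qed
  from mn obtain c where c: "?n = ?m * c" ..
  with ne have "c \<noteq> 1" by simp
  then obtain p where p: "prime p" "p dvd c" using prime_factor_nat by blast
  then have mpn: "?m * p dvd ?n" using c by simp
  obtain l where l: "?n = p ^ multiplicity p ?n * l" "\<not> p dvd l"
    using multiplicity_decompose'[of ?n p] n0 p by (metis not_gr_zero not_prime_unit)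
  define a where "a = multiplicity p ?n"
  have "\<not> p ^ a dvd ?m"
  proof
    assume "p ^ a dvd ?m"
    then have "p ^ a * p dvd ?m * p" by (rule mult_dvd_mono) simp
    then have "p ^ a * p dvd p ^ a * l" using mpn l(1) a_def dvd_trans by metis
    then show False using l(2) p by (simp add: prime_gt_0_nat)
  qed
  moreover have "p ^ a dvd ?n" using l(1) a_def by (metis dvd_triv_left)
  ultimately have "?m dvd p ^ a" using comparable by blast
  then obtain b where b: "?m = p ^ b" using p(1) divides_primepow_nat by blast
  have b0: "b \<noteq> 0" using b m1 by (cases b) auto
  have "q = p" if q: "prime q" "q dvd ?n" for q
  proof -
    from comparable[OF q(2)] show ?thesis
    proof
      assume "q dvd ?m"
      then show ?thesis using q(1) p(1) b prime_dvd_power primes_dvd_imp_eq by metis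
    next
      assume "?m dvd q"
      moreover have "p dvd ?m" using b b0 by (simp add: dvd_power)
      ultimately show ?thesis using q(1) p(1) dvd_trans primes_dvd_imp_eq by metis
    qed
  qed
  then obtain k where k: "?n = p ^ k"
    using prime_power_of_unique_prime_divisor[OF n0 p(1)] by blast
  have "\<exists>k. ord w = p ^ k" if w: "w \<in> carrier G" and yw: "y \<in> cyc w" for w
  proof -
    have "q = p" if q: "prime q" "q dvd ord w" for q
    proof (rule ccontr)
      assume qp: "q \<noteq> p"
      have cop: "coprime ?m q" using b q(1) p(1) qp by (simp add: primes_coprime)
      have "?m * q dvd ord w"
        using cop q(2) ord_dvd_of_mem_cyc[OF w yw] by (simp add: divides_mult)
      then obtain u where u: "u \<in> cyc w" "ord u = ?m * q" using ex_ord_in_cyc[OF w] by blast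
      have uG: "u \<in> carrier G" using u w cyc_carrier by blast
      have "y \<in> cyc u" using mem_cyc_iff_ord_dvd[OF w yw u(1)] u(2) by simp
      then have "adj y u" by (simp add: adj_def)
      then have "adj x u" using adj_cong_nbhd[OF nb uG] by simp
      then consider "?m * q dvd ?n" | "?n dvd ?m * q"
        using adj_ord_dvd[OF x uG] u(2) by auto
      then show False
      proof cases
        case 1
        then have "q dvd p ^ k" using k by (metis dvd_mult_right)
        then show False using q(1) p(1) qp prime_dvd_power primes_dvd_imp_eq by metis
      next
        case 2
        moreover have "coprime ?n q" using k q(1) p(1) qp by (simp add: primes_coprime)
        ultimately have "?n dvd ?m" using coprime_dvd_mult_left_iff by blast
        then show False using mn ne dvd_antisym by blast
      qed
    qed
    then show ?thesis
      using prime_power_of_unique_prime_divisor[OF ord_pos[OF w] p(1)] by blast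
  qed
  with p(1) show thesis using that by blast
qed

text \<open>If \<open>\<langle>y\<rangle> \<noteq> \<langle>x\<rangle>\<close>, then \<open>x\<close> has prime power order, so that \<open>\<langle>x\<rangle>\<close> is totally ordered and all its
  elements are adjacent to \<open>b\<close>. A neighbour of \<open>b\<close> outside \<open>\<langle>x\<rangle>\<close> is above \<open>b\<close>, thus above \<open>y\<close> and
  therefore a neighbour of \<open>x\<close>; a neighbour of \<open>x\<close> outside \<open>\<langle>x\<rangle>\<close> is above \<open>x\<close> and thus above \<open>b\<close>.\<close>

lemma nbhd_convex:
  assumes x: "x \<in> carrier G" and bx: "b \<in> cyc x" and yb: "y \<in> cyc b"
    and y1: "y \<noteq> \<one>" and nb: "nbhd y = nbhd x"
  shows "nbhd b = nbhd x"
proof -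
  have b: "b \<in> carrier G" using x bx cyc_carrier by blast
  have y: "y \<in> carrier G" using b yb cyc_carrier by blast
  have yx: "y \<in> cyc x" using cyc_trans x bx yb .
  show ?thesis
  proof (cases "ord y = ord x")
    case True
    then have "x \<in> cyc y" using mem_cyc_iff_ord_dvd[OF x self_in_cyc yx] by simp
    then have "x \<in> cyc b" using cyc_trans b yb by blast
    then show ?thesis using nbhd_eq_of_mutual x bx by blast
  next
    case False
    from prime_power_above_twin[OF x yx y1 nb False] obtain p where "prime p"
      and pow: "\<And>w. w \<in> carrier G \<Longrightarrow> y \<in> cyc w \<Longrightarrow> \<exists>k. ord w = p ^ k" by blast
    obtain k where k: "ord x = p ^ k" using pow[OF x yx] ..
    have chain: "adj b w" if "w \<in> cyc x" for w
    proof -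
      have "ord b dvd p ^ k" "ord w dvd p ^ k"
        using ord_dvd_of_mem_cyc[OF x] bx that k by auto
      then obtain i j where "ord b = p ^ i" "ord w = p ^ j"
        using \<open>prime p\<close>
          divides_primepow_nat by metis
      then have "ord b dvd ord w \<or> ord w dvd ord b" by (metis le_imp_power_dvd nat_le_linear)
      then show ?thesis
        using mem_cyc_iff_ord_dvd[OF x bx that] mem_cyc_iff_ord_dvd[OF x that bx]
        by (auto simp: adj_def)
    qed
    show ?thesis
    proof (intro equalityI subsetI)
      fix w assume "w \<in> nbhd b"
      then have w: "w \<in> carrier G" and "w \<in> cyc b \<or> b \<in> cyc w" by (auto simp: nbhd_def adj_def)
      then have "w \<in> cyc x \<or> y \<in> cyc w" using cyc_trans x bx yb w by blast
      then have "adj x w \<or> adj y w" by (auto simp: adj_def)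
      then show "w \<in> nbhd x" using w adj_cong_nbhd[OF nb w] by (simp add: nbhd_def)
    next
      fix w assume "w \<in> nbhd x"
      then have w: "w \<in> carrier G" and "w \<in> cyc x \<or> x \<in> cyc w" by (auto simp: nbhd_def adj_def)
      then have "w \<in> cyc x \<or> b \<in> cyc w" using cyc_trans[OF w _ bx] by blast
      then show "w \<in> nbhd b" using chain w by (auto simp: nbhd_def adj_def)
    qed
  qed
qed

section \<open>Element orders in a twin class\<close>

text \<open>These are the elements strictly below the whole twin class of \<open>x\<close>: by \<open>gap_twin\<close> the set
  depends only on the class.\<close>

definition gap :: "'a \<Rightarrow> 'a set" where
  "gap x = cyc x - twins x"

text \<open>An element below the twin \<open>c\<close> of \<open>x\<close> is adjacent to \<open>x\<close>. If it were above \<open>x\<close>, it would lie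
  between two twins and hence belong to the class by convexity.\<close>

lemma gap_twin:
  assumes c: "c \<in> twins x" and x: "x \<in> carrier G" "x \<noteq> \<one>"
  shows "gap c = gap x"
proof -
  have sub: "gap u \<subseteq> gap v"
    if u: "u \<in> carrier G" and v: "v \<in> carrier G" "v \<noteq> \<one>" and nb: "nbhd u = nbhd v" for u v
  proof
    fix b assume b: "b \<in> gap u"
    then have bu: "b \<in> cyc u" and nt: "b \<notin> twins u" by (auto simp: gap_def)
    have bG: "b \<in> carrier G" using u bu cyc_carrier by blast
    have "adj v b" using adj_cong_nbhd[OF nb bG] bu by (simp add: adj_def)
    moreover have "v \<notin> cyc b"
    proof
      assume vb: "v \<in> cyc b"
      then have "nbhd b = nbhd u" using nbhd_convex[OF u bu vb v(2)] nb by simp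
      moreover have "b \<noteq> \<one>" using vb v(2) cyc_one by auto
      ultimately show False using nt bG by (simp add: twins_def)
    qed
    ultimately show "b \<in> gap v" using nt twins_cong[OF nb] by (auto simp: adj_def gap_def)
  qed
  from c have "c \<in> carrier G" "c \<noteq> \<one>" "nbhd c = nbhd x" by (auto simp: twins_def)
  then show ?thesis using sub[of c x] sub[of x c] x by auto
qed

text \<open>Twins are adjacent to each other, so a twin of maximal order generates all others.\<close>

lemma obtain_top_twin:
  assumes x: "x \<in> carrier G" "x \<noteq> \<one>"
  obtains t where "t \<in> twins x" "twins x \<subseteq> cyc t"
proof -
  have ne: "twins x \<noteq> {}" using self_in_twins x by blast
  have fin: "finite (twins x)" by (rule finite_twins)
  have "Max (ord ` twins x) \<in> ord ` twins x" using ne fin by (intro Max_in) auto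
  then obtain t where t: "t \<in> twins x" and tmax: "ord t = Max (ord ` twins x)" by auto
  have "z \<in> cyc t" if z: "z \<in> twins x" for z
  proof -
    have tz: "t \<in> carrier G" "z \<in> carrier G" "nbhd t = nbhd z"
      using t z by (auto simp: twins_def)
    then have adj: "adj t z" using adj_of_nbhd_eq by blast
    have le: "ord z \<le> ord t" using tmax z fin by simp
    have "ord z dvd ord t"
      using adj_ord_dvd[OF tz(1,2) adj] le ord_pos[OF tz(2)] by (metis dvd_imp_le dvd_refl le_antisym)
    then show ?thesis using mem_cyc_iff_of_adj[OF tz(1,2) adj] by simp
  qed
  then show thesis using that t by blast
qed

lemma ord_top_twin:
  assumes x: "x \<in> carrier G" "x \<noteq> \<one>" and t: "t \<in> twins x" "twins x \<subseteq> cyc t"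
  shows "ord t = card (gap x) + card (twins x)"
proof -
  have tG: "t \<in> carrier G" and nb: "nbhd t = nbhd x" using t by (auto simp: twins_def)
  have "gap x = cyc t - twins x"
    using gap_twin[OF t(1) x] twins_cong[OF nb] by (simp add: gap_def)
  then have "card (gap x) = ord t - card (twins x)"
    using t(2) by (simp add: card_Diff_subset finite_twins card_cyc tG)
  moreover have "card (twins x) \<le> ord t"
    using card_mono[OF finite_cyc[OF tG] t(2)] card_cyc tG by simp
  ultimately show ?thesis by simp
qed

text \<open>A twin \<open>z\<close> has the whole gap in \<open>\<langle>z\<rangle>\<close>, and itself in addition. Conversely, if \<open>z \<in> \<langle>t\<rangle>\<close> is not
  a twin, then convexity keeps all of \<open>\<langle>z\<rangle>\<close> inside the gap.\<close>

lemma twins_eq_ord_gt_gap: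
  assumes x: "x \<in> carrier G" "x \<noteq> \<one>" and t: "t \<in> twins x" "twins x \<subseteq> cyc t"
  shows "twins x = {z \<in> cyc t. card (gap x) < ord z}"
proof -
  have tG: "t \<in> carrier G" and nb: "nbhd t = nbhd x" using t by (auto simp: twins_def)
  have "card (gap x) < ord z" if z: "z \<in> twins x" for z
  proof -
    have zG: "z \<in> carrier G" and "nbhd z = nbhd x" using z by (auto simp: twins_def)
    then have "gap x \<subset> cyc z"
      using gap_twin[OF z x] z self_in_cyc[of z] twins_cong[of z x] by (auto simp: gap_def)
    then show ?thesis using psubset_card_mono[OF finite_cyc[OF zG]] card_cyc[OF zG] by simp
  qed
  moreover have "z \<in> twins x" if z: "z \<in> cyc t" and gt: "card (gap x) < ord z" for z
  proof (rule ccontr)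
    assume nz: "z \<notin> twins x"
    have zG: "z \<in> carrier G" using z tG cyc_carrier by blast
    have "w \<notin> twins x" if w: "w \<in> cyc z" for w
    proof
      assume wt: "w \<in> twins x"
      then have w1: "w \<noteq> \<one>" "nbhd w = nbhd t" using nb by (auto simp: twins_def)
      then have "nbhd z = nbhd x" using nbhd_convex[OF tG z w] nb by simp
      moreover have "z \<noteq> \<one>" using w w1 cyc_one by auto
      ultimately show False using nz zG by (simp add: twins_def)
    qed
    then have "cyc z \<subseteq> gap t" using cyc_mono[OF tG z] twins_cong[OF nb] by (auto simp: gap_def)
    then have "cyc z \<subseteq> gap x" using gap_twin[OF t(1) x] by simp
    moreover have "finite (gap x)" using finite_cyc x by (simp add: gap_def)
    ultimately show False using gt card_mono card_cyc[OF zG] by (metis not_less)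
  qed
  ultimately show ?thesis using t(2) by blast
qed

lemma card_twins_of_ord:
  assumes x: "x \<in> carrier G" "x \<noteq> \<one>"
  shows "card {z \<in> twins x. ord z = d} =
    (if d dvd card (gap x) + card (twins x) \<and> card (gap x) < d then totient d else 0)"
proof -
  obtain t where t: "t \<in> twins x" "twins x \<subseteq> cyc t" using obtain_top_twin[OF x] .
  have tG: "t \<in> carrier G" using t by (auto simp: twins_def)
  note n = ord_top_twin[OF x t] and eq = twins_eq_ord_gt_gap[OF x t]
  show ?thesis
  proof (cases "d dvd ord t \<and> card (gap x) < d")
    case True
    then have "{z \<in> twins x. ord z = d} = {z \<in> cyc t. ord z = d}" using eq by auto
    then show ?thesis using True n card_ord_in_cyc[OF tG] by simp
  next
    case False
    have e: "{z \<in> twins x. ord z = d} = {}"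
      using False eq ord_dvd_of_mem_cyc[OF tG] by auto
    show ?thesis unfolding e using False n by simp
  qed
qed


section \<open>Sizes of adjacent twin classes\<close>

lemma totient_le_card_twins:
  assumes x: "x \<in> carrier G" "x \<noteq> \<one>"
  shows "totient (ord x) \<le> card (twins x)"
proof -
  have "{z \<in> cyc x. ord z = ord x} \<subseteq> twins x"
  proof
    fix z assume "z \<in> {z \<in> cyc x. ord z = ord x}"
    then have z: "z \<in> cyc x" "ord z = ord x" by auto
    then have "x \<in> cyc z" using mem_cyc_iff_ord_dvd[OF x(1) self_in_cyc z(1)] by simp
    then have "nbhd x = nbhd z" using nbhd_eq_of_mutual x z by blast
    moreover have "z \<noteq> \<one>" using z(2) ord_gt_1[OF x] by auto
    ultimately show "z \<in> twins x" using cyc_carrier[OF x(1) z(1)] by (simp add: twins_def)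
  qed
  then have "card {z \<in> cyc x. ord z = ord x} \<le> card (twins x)"
    by (rule card_mono[OF finite_twins])
  then show ?thesis using card_ord_in_cyc[OF x(1), of "ord x"] by simp
qed

lemma ord_eq_2_of_card_twins_eq_1:
  assumes z: "z \<in> carrier G" "z \<noteq> \<one>" and c: "card (twins z) = 1"
  shows "ord z = 2"
  using totient_le_card_twins[OF z] totient_gt_1[of "ord z"] ord_gt_1[OF z] c by linarith

text \<open>A further twin of the involution \<open>z\<close> would have another order, which forces all elements above
  \<open>z\<close> to have orders that are powers of \<open>2\<close>; but \<open>ord x\<close> has the odd divisor \<open>d\<close>.\<close>

lemma involution_twins:
  assumes x: "x \<in> carrier G" and z: "z \<in> cyc x" and z2: "ord z = 2"
    and n: "d dvd ord x" "odd d" "d > 1"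
  shows "twins z = {z}"
proof -
  have zG: "z \<in> carrier G" using x z cyc_carrier by blast
  have z1: "z \<noteq> \<one>" using z2 ord_id by auto
  have cz: "cyc z = {\<one>, z}"
  proof -
    have "{\<one>, z} \<subseteq> cyc z" using one_in_cyc self_in_cyc by blast
    moreover have "card {\<one>, z} = card (cyc z)" using z1 z2 card_cyc[OF zG] by simp
    ultimately show ?thesis using card_subset_eq[OF finite_cyc[OF zG]] by blast
  qed
  have "w = z" if w: "w \<in> twins z" for w
  proof (rule ccontr)
    assume wz: "w \<noteq> z"
    have wG: "w \<in> carrier G" and w1: "w \<noteq> \<one>" and nb: "nbhd w = nbhd z"
      using w by (auto simp: twins_def)
    have "w \<notin> cyc z" using cz w1 wz by blast
    moreover have "adj w z" using adj_of_nbhd_eq[OF wG nb] .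
    ultimately have zw: "z \<in> cyc w" by (auto simp: adj_def)
    have "ord z \<noteq> ord w"
      using \<open>w \<notin> cyc z\<close> mem_cyc_iff_ord_dvd[OF wG self_in_cyc zw] by auto
    then obtain p where p: "prime p"
      and pow: "\<And>u. u \<in> carrier G \<Longrightarrow> z \<in> cyc u \<Longrightarrow> \<exists>k. ord u = p ^ k"
      using prime_power_above_twin[OF wG zw z1 nb[symmetric]] by blast
    obtain k where "ord z = p ^ k" using pow[OF zG self_in_cyc] ..
    then have "2 dvd p" using z2 prime_dvd_power two_is_prime_nat by (metis dvd_refl)
    then have "p = 2" using p primes_dvd_imp_eq two_is_prime_nat by blast
    then obtain l where "ord x = 2 ^ l" using pow[OF x z] by auto
    then obtain i where "d = 2 ^ i" using n(1) divides_primepow_nat two_is_prime_nat by metis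
    then show False using n by (cases i) auto
  qed
  then show ?thesis using self_in_twins[OF zG z1] by blast
qed

text \<open>
  Let \<open>t\<close> be a twin of \<open>y\<close> that generates all others. If some twin has another order, then
  \<open>ord t\<close> is a proper divisor of the prime power \<open>ord x = p ^ c\<close>, and the class of \<open>y\<close>, a subset
  of \<open>\<langle>t\<rangle>\<close> without the identity, is smaller than \<open>p ^ (c - 1) \<le> totient (ord x)\<close>. If all twins have the
  same order, there are at most \<open>totient (ord t) \<le> totient (ord x)\<close> of them. The alternative
  \<open>equal\<close> does occur, for instance for elements of orders \<open>3\<close> and \<open>6\<close> in a cyclic group of
  order \<open>6\<close>; its witness \<open>z\<close>, an involution in \<open>\<langle>x\<rangle>\<close>, tells the two classes apart.
\<close>

lemma card_twins_cases:
  assumes x: "x \<in> carrier G" and yx: "y \<in> cyc x" and y1: "y \<noteq> \<one>"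
    and ne: "nbhd y \<noteq> nbhd x"
  obtains (less) "card (twins y) < card (twins x)"
  | (equal) z where "card (twins y) = card (twins x)" "odd (ord y)"
      "z \<in> nbhd x" "z \<noteq> \<one>" "card (twins z) = 1"
proof -
  have y: "y \<in> carrier G" using x yx cyc_carrier by blast
  have x1: "x \<noteq> \<one>" using yx y1 cyc_one by auto
  obtain t where t: "t \<in> twins y" "twins y \<subseteq> cyc t" using obtain_top_twin[OF y y1] .
  have tG: "t \<in> carrier G" and t1: "t \<noteq> \<one>" and nbt: "nbhd t = nbhd y"
    using t by (auto simp: twins_def)
  have yt: "y \<in> cyc t" using t(2) self_in_twins[OF y y1] by blast
  have "adj t x" using adj_cong_nbhd[OF nbt x] yx by (simp add: adj_def)
  moreover have xt: "x \<notin> cyc t"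
    using nbhd_convex[OF tG _ yx y1 nbt[symmetric]] nbt ne by auto
  ultimately have tx: "t \<in> cyc x" by (auto simp: adj_def)
  have mn: "ord t dvd ord x" using ord_dvd_of_mem_cyc[OF x tx] .
  have mn_ne: "ord t \<noteq> ord x"
    using xt mem_cyc_iff_ord_dvd[OF x self_in_cyc tx] by auto
  show thesis
  proof (cases "\<exists>u\<in>twins y. ord u \<noteq> ord t")
    case True
    then obtain u where u: "u \<in> twins y" "ord u \<noteq> ord t" by blast
    have ut: "u \<in> cyc t" and u1: "u \<noteq> \<one>" and nbu: "nbhd u = nbhd t"
      using u t(2) nbt by (auto simp: twins_def)
    obtain p where p: "prime p"
      and pow: "\<And>w. w \<in> carrier G \<Longrightarrow> u \<in> cyc w \<Longrightarrow> \<exists>k. ord w = p ^ k"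
      using prime_power_above_twin[OF tG ut u1 nbu u(2)] by blast
    obtain r where r: "ord t = p ^ r" using pow[OF tG ut] by blast
    obtain c where c: "ord x = p ^ c" using pow[OF x cyc_trans[OF x tx ut]] by blast
    have p1: "p > 1" using p prime_gt_1_nat by blast
    have "ord t < ord x" using mn mn_ne ord_pos[OF x] by (simp add: dvd_imp_le le_neq_implies_less)
    then have rc: "r < c" using r c p1 by simp
    have "card (twins y) < ord t"
    proof -
      have "twins y \<subset> cyc t" using t(2) one_in_cyc by (auto simp: twins_def)
      then show ?thesis using psubset_card_mono[OF finite_cyc[OF tG]] card_cyc[OF tG] by simp
    qed
    also have "ord t \<le> p ^ (c - 1)" using r rc p1 by (simp add: power_increasing)
    also have "\<dots> \<le> p ^ (c - 1) * (p - 1)" using p1 by simp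
    also have "\<dots> = totient (ord x)" using c rc p by (simp add: totient_prime_power)
    also have "\<dots> \<le> card (twins x)" using totient_le_card_twins[OF x x1] .
    finally show thesis by (rule less)
  next
    case False
    then have "twins y \<subseteq> {z \<in> cyc t. ord z = ord t}" using t(2) by auto
    then have le1: "card (twins y) \<le> totient (ord t)"
      using card_mono[of "{z \<in> cyc t. ord z = ord t}"] finite_cyc[OF tG]
        card_ord_in_cyc[OF tG, of "ord t"] by fastforce
    have le2: "totient (ord t) \<le> totient (ord x)" using totient_dvd_mono[OF mn ord_pos[OF x]] .
    have le3: "totient (ord x) \<le> card (twins x)" using totient_le_card_twins[OF x x1] .
    show thesis
    proof (cases "card (twins y) < card (twins x)")
      case True
      then show thesis by (rule less)
    next
      case nless: False
      then have "totient (ord t) = totient (ord x)" and eq: "card (twins y) = card (twins x)"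
        using le1 le2 le3 by auto
      then have odd_even: "odd (ord t)" "even (ord x)"
        using totient_eq_imp_odd[OF mn mn_ne ord_pos[OF x]] by auto
      obtain z where z: "z \<in> cyc x" "ord z = 2" using ex_ord_in_cyc[OF x odd_even(2)] .
      have "twins z = {z}"
        using involution_twins[OF x z mn odd_even(1) ord_gt_1[OF tG t1]] .
      moreover have "z \<noteq> \<one>" using z(2) by auto
      moreover have "z \<in> nbhd x" using z(1) cyc_carrier[OF x] by (simp add: nbhd_def adj_def)
      moreover have "odd (ord y)" using odd_even(1) ord_dvd_of_mem_cyc[OF tG yt] dvd_trans by blast
      ultimately show thesis using equal eq by simp
    qed
  qed
qed

end


section \<open>Isomorphisms of power graphs\<close>

text \<open>Bijections between corresponding fibres are glued together.\<close>

lemma ex_bij_betw_of_card_fibres: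
  assumes "finite A" "finite B"
    and card: "\<And>k. card {x \<in> A. \<kappa> x = k} = card {y \<in> B. \<mu> y = k}"
  shows "\<exists>g. bij_betw g A B \<and> (\<forall>x\<in>A. \<mu> (g x) = \<kappa> x)"
proof -
  have "\<exists>h. bij_betw h {x \<in> A. \<kappa> x = k} {y \<in> B. \<mu> y = k}" for k
    using finite_same_card_bij[of "{x \<in> A. \<kappa> x = k}" "{y \<in> B. \<mu> y = k}"] assms by simp
  then obtain h where h: "\<And>k. bij_betw (h k) {x \<in> A. \<kappa> x = k} {y \<in> B. \<mu> y = k}" by metis
  define g where "g x = h (\<kappa> x) x" for x
  have g: "g x \<in> B" "\<mu> (g x) = \<kappa> x" if "x \<in> A" for x
    using bij_betw_apply[OF h, of x "\<kappa> x"] that by (auto simp: g_def)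
  have "inj_on g A"
  proof (rule inj_onI)
    fix x x' assume x: "x \<in> A" "x' \<in> A" and eq: "g x = g x'"
    then have "\<kappa> x = \<kappa> x'" using g by metis
    then show "x = x'"
      using eq x bij_betw_imp_inj_on[OF h, of "\<kappa> x"] by (auto simp: g_def inj_on_def)
  qed
  moreover have "B \<subseteq> g ` A"
  proof
    fix y assume "y \<in> B"
    then have "y \<in> h (\<mu> y) ` {x \<in> A. \<kappa> x = \<mu> y}"
      using bij_betw_imp_surj_on[OF h[of "\<mu> y"]] by blast
    then obtain x where "x \<in> A" "\<kappa> x = \<mu> y" "y = h (\<mu> y) x" by blast
    then have "x \<in> A" "y = g x" by (simp_all add: g_def)
    then show "y \<in> g ` A" by blast
  qed
  moreover have "g ` A \<subseteq> B" using g(1) by blast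
  ultimately have "bij_betw g A B" by (simp add: bij_betw_def subset_antisym)
  with g(2) show ?thesis by blast
qed

text \<open>An isomorphism of power graphs, in terms of reflexive adjacency, that fixes the identity.
  The last condition makes \<open>f\<close> respect the twin classes of non-identity elements.\<close>

locale power_graph_iso = dom: finite_group G + cod: finite_group H
  for G (structure) and H (structure) +
  fixes f
  assumes bij: "bij_betw f (carrier G) (carrier H)"
    and adj_iff: "\<And>x y. x \<in> carrier G \<Longrightarrow> y \<in> carrier G \<Longrightarrow> cod.adj (f x) (f y) \<longleftrightarrow> dom.adj x y"
    and f_one: "f \<one>\<^bsub>G\<^esub> = \<one>\<^bsub>H\<^esub>"
begin

lemma f_carrier: "x \<in> carrier G \<Longrightarrow> f x \<in> carrier H"
  using bij by (auto simp: bij_betw_def)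

lemma f_eq_iff: "x \<in> carrier G \<Longrightarrow> y \<in> carrier G \<Longrightarrow> f x = f y \<longleftrightarrow> x = y"
  using bij by (auto simp: bij_betw_def inj_on_eq_iff)

lemma f_eq_one_iff: "x \<in> carrier G \<Longrightarrow> f x = \<one>\<^bsub>H\<^esub> \<longleftrightarrow> x = \<one>\<^bsub>G\<^esub>"
  using f_eq_iff[of x "\<one>\<^bsub>G\<^esub>"] f_one by simp

lemma f_surj: "y \<in> carrier H \<Longrightarrow> \<exists>x\<in>carrier G. y = f x"
  using bij by (auto simp: bij_betw_def)

lemma nbhd_image:
  assumes "x \<in> carrier G"
  shows "cod.nbhd (f x) = f ` dom.nbhd x"
proof -
  have "y \<in> cod.nbhd (f x) \<longleftrightarrow> y \<in> f ` dom.nbhd x" for y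
  proof (cases "y \<in> carrier H")
    case True
    then obtain z where z: "z \<in> carrier G" "y = f z" using f_surj by blast
    have "f z \<in> f ` dom.nbhd x \<longleftrightarrow> z \<in> dom.nbhd x"
      using z(1) f_eq_iff by (auto simp: dom.nbhd_def)
    then show ?thesis
      using z True adj_iff[OF assms z(1)] by (simp add: dom.nbhd_def cod.nbhd_def)
  next
    case False
    then show ?thesis using f_carrier by (auto simp: dom.nbhd_def cod.nbhd_def)
  qed
  then show ?thesis by blast
qed

lemma nbhd_eq_iff:
  assumes "x \<in> carrier G" "y \<in> carrier G"
  shows "cod.nbhd (f x) = cod.nbhd (f y) \<longleftrightarrow> dom.nbhd x = dom.nbhd y"
proof -
  have "inj_on f (carrier G)" using bij by (simp add: bij_betw_def)
  moreover have "dom.nbhd x \<subseteq> carrier G" "dom.nbhd y \<subseteq> carrier G" by (auto simp: dom.nbhd_def)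
  ultimately show ?thesis using assms by (simp add: nbhd_image inj_on_image_eq_iff)
qed

lemma card_image_f: "A \<subseteq> carrier G \<Longrightarrow> card (f ` A) = card A"
  using bij by (meson bij_betw_def card_image inj_on_subset)

lemma twins_image:
  assumes "x \<in> carrier G"
  shows "cod.twins (f x) = f ` dom.twins x"
proof -
  have "y \<in> cod.twins (f x) \<longleftrightarrow> y \<in> f ` dom.twins x" for y
  proof (cases "y \<in> carrier H")
    case True
    then obtain z where z: "z \<in> carrier G" "y = f z" using f_surj by blast
    have "f z \<in> f ` dom.twins x \<longleftrightarrow> z \<in> dom.twins x"
      using z(1) f_eq_iff by (auto simp: dom.twins_def)
    then show ?thesis
      using z True nbhd_eq_iff[OF z(1) assms] f_eq_one_iff[OF z(1)]
      by (simp add: dom.twins_def cod.twins_def)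
  next
    case False
    then show ?thesis using f_carrier by (auto simp: dom.twins_def cod.twins_def)
  qed
  then show ?thesis by blast
qed

lemma card_twins: "x \<in> carrier G \<Longrightarrow> card (cod.twins (f x)) = card (dom.twins x)"
  by (simp add: twins_image card_image_f dom.twins_def)

text \<open>Suppose \<open>f\<close> reverses an arc between different twin classes. Then \<open>card_twins_cases\<close> in both
  groups yields equal class sizes, and \<open>f x\<close>, being the lower element in \<open>H\<close>, has odd order. The
  neighbour of \<open>x\<close> that is its own twin class is mapped to a neighbour of \<open>f x\<close> with this
  property, which is therefore an involution and cannot be adjacent to \<open>f x\<close>.\<close>

lemma mem_cyc_image:
  assumes x: "x \<in> carrier G" and yx: "y \<in> dom.cyc x" and y1: "y \<noteq> \<one>\<^bsub>G\<^esub>"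
    and ne: "dom.nbhd y \<noteq> dom.nbhd x"
  shows "f y \<in> cod.cyc (f x)"
proof (rule ccontr)
  assume "f y \<notin> cod.cyc (f x)"
  have y: "y \<in> carrier G" using x yx dom.cyc_carrier by blast
  have x1: "x \<noteq> \<one>\<^bsub>G\<^esub>" using yx y1 dom.cyc_one by auto
  have "cod.adj (f x) (f y)" using adj_iff[OF x y] yx by (simp add: dom.adj_def)
  then have fxy: "f x \<in> cod.cyc (f y)" using \<open>f y \<notin> cod.cyc (f x)\<close> by (simp add: cod.adj_def)
  have fx: "f x \<in> carrier H" and fy: "f y \<in> carrier H" using f_carrier x y by auto
  have fx1: "f x \<noteq> \<one>\<^bsub>H\<^esub>" using f_eq_one_iff x x1 by simp
  have fne: "cod.nbhd (f x) \<noteq> cod.nbhd (f y)" using nbhd_eq_iff[OF x y] ne by simp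
  have cmp: "card (dom.twins x) < card (dom.twins y) \<or>
      card (dom.twins x) = card (dom.twins y) \<and> odd (cod.ord (f x))"
    by (rule cod.card_twins_cases[OF fy fxy fx1 fne])
      (simp_all add: card_twins[OF x] card_twins[OF y])
  from x yx y1 ne show False
  proof (cases rule: dom.card_twins_cases)
    case less
    then show False using cmp by simp
  next
    case (equal z)
    have odd: "odd (cod.ord (f x))" using cmp equal(1) by simp
    have z: "z \<in> carrier G" and xz: "dom.adj x z" using equal(3) by (auto simp: dom.nbhd_def)
    have fz: "f z \<in> carrier H" using f_carrier z .
    have "f z \<noteq> \<one>\<^bsub>H\<^esub>" using f_eq_one_iff z equal(4) by simp
    then have "cod.ord (f z) = 2"
      using cod.ord_eq_2_of_card_twins_eq_1[OF fz] card_twins[OF z] equal(5) by simp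
    moreover have "cod.adj (f x) (f z)" using adj_iff[OF x z] xz by simp
    ultimately have "cod.ord (f x) dvd 2 \<or> 2 dvd cod.ord (f x)"
      using cod.adj_ord_dvd[OF fx fz] by simp
    then have "cod.ord (f x) dvd 2" using odd by simp
    then have "cod.ord (f x) = 1" using odd by (metis dvd_refl prime_nat_iff two_is_prime_nat)
    then show False using cod.ord_gt_1[OF fx fx1] by simp
  qed
qed

lemma mem_cyc_iff:
  assumes x: "x \<in> carrier G" and y: "y \<in> carrier G" and y1: "y \<noteq> \<one>\<^bsub>G\<^esub>" and x1: "x \<noteq> \<one>\<^bsub>G\<^esub>"
    and ne: "dom.nbhd y \<noteq> dom.nbhd x"
  shows "f y \<in> cod.cyc (f x) \<longleftrightarrow> y \<in> dom.cyc x"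
proof
  show "y \<in> dom.cyc x \<Longrightarrow> f y \<in> cod.cyc (f x)" using mem_cyc_image[OF x _ y1 ne] .
  assume fyx: "f y \<in> cod.cyc (f x)"
  show "y \<in> dom.cyc x"
  proof (rule ccontr)
    assume "y \<notin> dom.cyc x"
    moreover have "dom.adj x y" using adj_iff[OF x y] fyx by (simp add: cod.adj_def)
    ultimately have "x \<in> dom.cyc y" by (simp add: dom.adj_def)
    then have "f x \<in> cod.cyc (f y)" using mem_cyc_image[OF y _ x1] ne by simp
    then have "cod.nbhd (f x) = cod.nbhd (f y)"
      using cod.nbhd_eq_of_mutual[OF f_carrier[OF x] fyx] by simp
    then show False using nbhd_eq_iff[OF x y] ne by simp
  qed
qed

lemma gap_image:
  assumes x: "x \<in> carrier G" and x1: "x \<noteq> \<one>\<^bsub>G\<^esub>"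
  shows "cod.gap (f x) = f ` dom.gap x"
proof -
  have fx: "f x \<in> carrier H" using f_carrier x .
  have iff: "f b \<in> cod.gap (f x) \<longleftrightarrow> b \<in> dom.gap x" if b: "b \<in> carrier G" for b
  proof (cases "b = \<one>\<^bsub>G\<^esub>")
    case True
    then show ?thesis
      using dom.one_in_cyc cod.one_in_cyc f_one
      by (simp add: dom.gap_def cod.gap_def dom.twins_def cod.twins_def)
  next
    case False
    then show ?thesis
      using mem_cyc_iff[OF x b False x1] nbhd_eq_iff[OF b x] f_eq_one_iff[OF b] b f_carrier[OF b]
      by (auto simp: dom.gap_def cod.gap_def dom.twins_def cod.twins_def)
  qed
  have "dom.gap x \<subseteq> carrier G" "cod.gap (f x) \<subseteq> carrier H"
    using dom.cyc_carrier[OF x] cod.cyc_carrier[OF fx] by (auto simp: dom.gap_def cod.gap_def)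
  then show ?thesis using iff f_surj by blast
qed

lemma card_gap: "x \<in> carrier G \<Longrightarrow> x \<noteq> \<one>\<^bsub>G\<^esub> \<Longrightarrow> card (cod.gap (f x)) = card (dom.gap x)"
  using dom.cyc_carrier[of x] by (subst gap_image) (auto intro!: card_image_f simp: dom.gap_def)

lemma card_twins_of_ord_eq:
  assumes "x \<in> carrier G" "x \<noteq> \<one>\<^bsub>G\<^esub>"
  shows "card {z \<in> cod.twins (f x). cod.ord z = d} = card {z \<in> dom.twins x. dom.ord z = d}"
  using dom.card_twins_of_ord[OF assms] cod.card_twins_of_ord[OF f_carrier[OF assms(1)]]
    f_eq_one_iff[OF assms(1)] assms(2) card_twins[OF assms(1)] card_gap[OF assms]
  by simp

text \<open>For order \<open>1\<close> the identity is all there is to count. Any other non-empty fibre is the set of elements of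
  order \<open>d\<close> in a twin class of non-identity elements.\<close>

lemma card_nbhd_ord_fibre:
  "card {x \<in> carrier G. (cod.nbhd (f x), dom.ord x) = k} =
   card {y \<in> carrier H. (cod.nbhd y, cod.ord y) = k}" (is "card ?A = card ?B")
proof -
  obtain N d where k: "k = (N, d)" by (cases k)
  show ?thesis
  proof (cases "d = 1")
    case True
    have "?A = (if N = cod.nbhd \<one>\<^bsub>H\<^esub> then {\<one>\<^bsub>G\<^esub>} else {})"
      using k True dom.ord_eq_1 f_one by auto
    moreover have "?B = (if N = cod.nbhd \<one>\<^bsub>H\<^esub> then {\<one>\<^bsub>H\<^esub>} else {})"
      using k True cod.ord_eq_1 by auto
    ultimately show ?thesis by simp
  next
    case d1: False
    show ?thesis
    proof (cases "\<exists>x\<in>carrier G. x \<noteq> \<one>\<^bsub>G\<^esub> \<and> cod.nbhd (f x) = N")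
      case True
      then obtain x where x: "x \<in> carrier G" "x \<noteq> \<one>\<^bsub>G\<^esub>" and N: "cod.nbhd (f x) = N" by blast
      have "?A = {z \<in> dom.twins x. dom.ord z = d}"
        using k d1 N x(1) nbhd_eq_iff by (auto simp: dom.twins_def)
      moreover have "?B = {z \<in> cod.twins (f x). cod.ord z = d}"
        using k d1 N by (auto simp: cod.twins_def)
      ultimately show ?thesis using card_twins_of_ord_eq[OF x] by simp
    next
      case False
      then have "?A = {}" using k d1 by auto
      moreover have "?B = {}"
      proof (rule ccontr)
        assume "?B \<noteq> {}"
        then obtain y where y: "y \<in> carrier H" "cod.nbhd y = N" "cod.ord y = d" using k by auto
        then obtain x where x: "x \<in> carrier G" "y = f x" using f_surj by blast
        have "x \<noteq> \<one>\<^bsub>G\<^esub>" using x y d1 f_one by auto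
        with False x y show False by blast
      qed
      ultimately show ?thesis by (simp only: card.empty)
    qed
  qed
qed

text \<open>The bijection \<open>g\<close> permutes the values of \<open>f\<close> within twin classes, hence it still preserves
  adjacency, and it is chosen so as to preserve orders too.\<close>

lemma ex_directed_iso:
  "\<exists>g. bij_betw g (carrier G) (carrier H) \<and>
    (\<forall>x\<in>carrier G. \<forall>y\<in>carrier G. g y \<in> cod.cyc (g x) \<longleftrightarrow> y \<in> dom.cyc x)"
proof -
  have "\<exists>g. bij_betw g (carrier G) (carrier H) \<and>
      (\<forall>x\<in>carrier G. (cod.nbhd (g x), cod.ord (g x)) = (cod.nbhd (f x), dom.ord x))"
    by (rule ex_bij_betw_of_card_fibres)
      (simp_all only: dom.finite_carrier cod.finite_carrier card_nbhd_ord_fibre)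
  then obtain g where g: "bij_betw g (carrier G) (carrier H)"
    and nb: "\<And>x. x \<in> carrier G \<Longrightarrow> cod.nbhd (g x) = cod.nbhd (f x)"
    and o: "\<And>x. x \<in> carrier G \<Longrightarrow> cod.ord (g x) = dom.ord x" by auto
  have gH: "g x \<in> carrier H" if "x \<in> carrier G" for x using g that by (auto simp: bij_betw_def)
  have "g y \<in> cod.cyc (g x) \<longleftrightarrow> y \<in> dom.cyc x" if x: "x \<in> carrier G" and y: "y \<in> carrier G" for x y
  proof -
    have "cod.adj (g x) (g y) \<longleftrightarrow> cod.adj (f x) (g y)"
      using cod.adj_cong_nbhd[OF nb[OF x] gH[OF y]] .
    also have "\<dots> \<longleftrightarrow> cod.adj (f x) (f y)"
      using cod.adj_cong_nbhd[OF nb[OF y] f_carrier[OF x]] cod.adj_commute by blast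
    also have "\<dots> \<longleftrightarrow> dom.adj x y" using adj_iff[OF x y] .
    finally have adj: "cod.adj (g x) (g y) \<longleftrightarrow> dom.adj x y" .
    show ?thesis
    proof (cases "dom.adj x y")
      case True
      then show ?thesis
        using dom.mem_cyc_iff_of_adj[OF x y] cod.mem_cyc_iff_of_adj[OF gH[OF x] gH[OF y]]
          adj o[OF x] o[OF y] by simp
    next
      case False
      then show ?thesis using adj by (auto simp: dom.adj_def cod.adj_def)
    qed
  qed
  with g show ?thesis by blast
qed

end

section \<open>Power graphs in terms of cyclic subgroups\<close>

context finite_group
begin

text \<open>The exponent \<open>0\<close> can be replaced by \<open>ord x\<close>.\<close>

lemma mem_cyc_iff_positive_power:
  assumes "x \<in> carrier G"
  shows "y \<in> cyc x \<longleftrightarrow> (\<exists>m::nat. m > 0 \<and> y = x [^] m)"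
proof
  assume "y \<in> cyc x"
  then obtain k :: nat where k: "y = x [^] k" using cyc_pow assms by auto
  then have "y = x [^] (k + ord x)" using assms by (simp flip: nat_pow_mult)
  then show "\<exists>m::nat. m > 0 \<and> y = x [^] m" using ord_pos[OF assms] by (metis add_gr_0)
qed (use cyc_pow assms in auto)

lemma arc_power_graph_iff:
  assumes "x \<in> carrier G" "y \<in> carrier G"
  shows "(x, y) \<in> parcs (power_graph G) \<longleftrightarrow> x \<noteq> y \<and> adj x y"
  using assms by (auto simp: power_graph_def adj_def mem_cyc_iff_positive_power)

lemma arc_directed_power_graph_iff:
  assumes "x \<in> carrier G" "y \<in> carrier G"
  shows "(x, y) \<in> parcs (directed_power_graph G) \<longleftrightarrow> x \<noteq> y \<and> y \<in> cyc x"
  using assms by (auto simp: directed_power_graph_def mem_cyc_iff_positive_power)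

text \<open>The identity and \<open>u\<close> are closed twins, so exchanging them is an automorphism.\<close>

lemma adj_transpose_universal:
  assumes u: "\<And>z. z \<in> carrier G \<Longrightarrow> adj u z" and x: "x \<in> carrier G" and y: "y \<in> carrier G"
  shows "adj (transpose \<one> u x) (transpose \<one> u y) \<longleftrightarrow> adj x y"
proof -
  have one: "adj \<one> z" "adj z \<one>" for z by (simp_all add: adj_def one_in_cyc)
  have u': "adj z u" if "z \<in> carrier G" for z using u[OF that] adj_commute by blast
  show ?thesis
    using one adj_refl u[OF x] u[OF y] u'[OF x] u'[OF y] by (simp add: transpose_def)
qed

end

theorem corollary21:
  fixes G1 :: "('a, 'm) monoid_scheme" and G2 :: "('b, 'n) monoid_scheme"
  assumes "group G1" and "finite (carrier G1)"
    and "group G2" and "finite (carrier G2)"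
    and "digraph_iso (with_proj (power_graph G1)) (with_proj (power_graph G2))"
  shows "digraph_iso (with_proj (directed_power_graph G1)) (with_proj (directed_power_graph G2))"
proof -
  interpret A: finite_group G1
    using assms by (intro finite_group.intro finite_group_axioms.intro)
  interpret B: finite_group G2
    using assms by (intro finite_group.intro finite_group_axioms.intro)
  have wf: "pair_wf_digraph (power_graph G1)" "pair_wf_digraph (power_graph G2)"
    using pair_graph_power_graph[OF assms(2)] pair_graph_power_graph[OF assms(4)]
    by (auto simp: pair_graph_def pair_digraph_def pair_fin_digraph_def)
  have wf': "pair_wf_digraph (directed_power_graph G1)" "pair_wf_digraph (directed_power_graph G2)"
    using pair_digraph_directed_power_graph[OF assms(2)]
      pair_digraph_directed_power_graph[OF assms(4)]
    by (auto simp: pair_digraph_def pair_fin_digraph_def)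
  have pv: "pverts (power_graph G1) = carrier G1" "pverts (power_graph G2) = carrier G2"
    "pverts (directed_power_graph G1) = carrier G1" "pverts (directed_power_graph G2) = carrier G2"
    by (simp_all add: power_graph_def directed_power_graph_def)
  obtain f where f: "bij_betw f (carrier G1) (carrier G2)"
    and f_arc: "\<forall>x\<in>carrier G1. \<forall>y\<in>carrier G1.
      (x, y) \<in> parcs (power_graph G1) \<longleftrightarrow> (f x, f y) \<in> parcs (power_graph G2)"
    using assms(5) unfolding digraph_iso_pair_iff[OF wf] pv by blast
  have f_carrier: "f x \<in> carrier G2" if "x \<in> carrier G1" for x
    using f that by (auto simp: bij_betw_def)
  have f_adj: "B.adj (f x) (f y) \<longleftrightarrow> A.adj x y" if x: "x \<in> carrier G1" and y: "y \<in> carrier G1" for x y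
  proof (cases "x = y")
    case True
    then show ?thesis by (simp add: A.adj_refl B.adj_refl)
  next
    case False
    then have "f x \<noteq> f y" using f x y by (auto simp: bij_betw_def inj_on_eq_iff)
    then show ?thesis
      using False f_arc x y A.arc_power_graph_iff[OF x y]
        B.arc_power_graph_iff[OF f_carrier[OF x] f_carrier[OF y]] by simp
  qed
  \<comment> \<open>The preimage \<open>u\<close> of the identity is adjacent to everything, so it can be exchanged with
    the identity of \<open>G1\<close> to make the isomorphism fix the identity.\<close>
  obtain u where u: "u \<in> carrier G1" "f u = \<one>\<^bsub>G2\<^esub>"
    using f by (metis B.one_closed bij_betw_iff_bijections)
  have u_adj: "A.adj u z" if "z \<in> carrier G1" for z
    using f_adj[OF u(1) that] u(2) by (simp add: B.adj_def B.one_in_cyc)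
  let ?s = "transpose \<one>\<^bsub>G1\<^esub> u"
  have s: "bij_betw ?s (carrier G1) (carrier G1)" using u(1) by (simp add: bij_betw_transpose_iff)
  have s_carrier: "?s x \<in> carrier G1" if "x \<in> carrier G1" for x
    using s that by (auto simp: bij_betw_def)
  interpret power_graph_iso G1 G2 "f \<circ> ?s"
  proof
    show "bij_betw (f \<circ> ?s) (carrier G1) (carrier G2)" using bij_betw_trans[OF s f] .
    show "(f \<circ> ?s) \<one>\<^bsub>G1\<^esub> = \<one>\<^bsub>G2\<^esub>" using u(2) by simp
    fix x y assume "x \<in> carrier G1" "y \<in> carrier G1"
    then show "B.adj ((f \<circ> ?s) x) ((f \<circ> ?s) y) \<longleftrightarrow> A.adj x y"
      using f_adj[OF s_carrier s_carrier] A.adj_transpose_universal[OF u_adj] by simp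
  qed
  obtain g where g: "bij_betw g (carrier G1) (carrier G2)"
    and g_cyc: "\<forall>x\<in>carrier G1. \<forall>y\<in>carrier G1. g y \<in> B.cyc (g x) \<longleftrightarrow> y \<in> A.cyc x"
    using ex_directed_iso by blast
  have "(x, y) \<in> parcs (directed_power_graph G1) \<longleftrightarrow> (g x, g y) \<in> parcs (directed_power_graph G2)"
    if x: "x \<in> carrier G1" and y: "y \<in> carrier G1" for x y
  proof -
    have "g x \<in> carrier G2" "g y \<in> carrier G2" and "g x = g y \<longleftrightarrow> x = y"
      using g x y by (auto simp: bij_betw_def inj_on_eq_iff)
    then show ?thesis
      using A.arc_directed_power_graph_iff[OF x y] B.arc_directed_power_graph_iff g_cyc x y by simp
  qed
  then show ?thesis unfolding digraph_iso_pair_iff[OF wf'] pv using g by blast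
qed

end
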